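(* Let $N\ge 2$ and let $\Omega \subseteq \mathbb{R}^N$ be an open set with $r_\Omega<+\infty$. Suppose that for some $r_0>0$ and $t\ge 0$ we have \[ t\le t_0,\qquad \theta^*_{\Omega,r_0}(t)\ge \theta>0\qquad \text{and}\qquad 0<\kappa_1\le \frac{r_0}{r_\Omega}\le \kappa_2. \] Then \[ \lambda(\Omega) \le C\,\big(h(\Omega)\big)^2, \] for some constant $C>0$ depending only on $N,t_0,\theta,\kappa_1,\kappa_2$. Finally, if $t_0=0$, the constant $C$ can be taken independent of $\kappa_2$.
   Context: $B_r(x)$ is the open Euclidean ball in $\mathbb{R}^N$ of center $x$ and radius $r$; $|\cdot|$ is Lebesgue measure; $\mathcal{H}^{N-1}$ is the $(N-1)$-dimensional Hausdorff measure; $C^\infty_0(\Omega)$ is the space of smooth functions with compact support in $\Omega$; $E\Subset\Omega$ means that $\overline{E}$ is compact and contained in $\Omega$. Inradius: $r_\Omega=\sup\{r>0 : \text{there exists a ball } B_r(x_0)\subseteq\Omega\}$. Bottom of the spectrum of the Dirichlet-Laplacian: $\lambda(\Omega)=\inf\{\int_\Omega |\nabla \varphi|^2\,dx : \varphi\in C^\infty_0(\Omega),\ \|\varphi\|_{L^2(\Omega)}=1\}$. Cheeger constant: $h(\Omega)=\inf\left\{\frac{\mathcal{H}^{N-1}(\partial E)}{|E|} : E\Subset \Omega\ \text{(nonempty) open set with smooth boundary}\right\}$. Measure density index: for $r_0>0$, $t\ge 0$, \[ \theta^*_{\Omega,r_0}(t)=\inf\left\{\left(\frac{r_0}{r}\right)^t\,\frac{|B_r(x)\setminus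 \Omega|}{|B_r(x)|} : x\in \partial \Omega,\ 0 < r \le r_0\right\}. \] *)

theory Defs
  imports "HOL-Analysis.Analysis"
begin

definition inradius :: "'a::euclidean_space set \<Rightarrow> ennreal" where
  "inradius \<Omega> = Sup {ennreal r |r. 0 < r \<and> (\<exists>x. ball x r \<subseteq> \<Omega>)}"

text \<open>Functions of class \<open>C\<^sup>k\<close> on the whole space, by iterated partial derivatives.\<close>

primrec C_k :: "nat \<Rightarrow> ('a::euclidean_space \<Rightarrow> real) \<Rightarrow> bool" where
  "C_k 0 f \<longleftrightarrow> continuous_on UNIV f"
| "C_k (Suc k) f \<longleftrightarrow> (\<forall>x. f differentiable (at x)) \<and>
     (\<forall>i\<in>Basis. C_k k (\<lambda>x. frechet_derivative f (at x) i))"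

definition smooth :: "('a::euclidean_space \<Rightarrow> real) \<Rightarrow> bool" where
  "smooth f \<longleftrightarrow> (\<forall>k. C_k k f)"

definition gradient :: "('a::euclidean_space \<Rightarrow> real) \<Rightarrow> 'a \<Rightarrow> 'a" where
  "gradient f x = (\<Sum>i\<in>Basis. frechet_derivative f (at x) i *\<^sub>R i)"

definition compactly_inside :: "'a::euclidean_space set \<Rightarrow> 'a set \<Rightarrow> bool" where
  "compactly_inside E \<Omega> \<longleftrightarrow> compact (closure E) \<and> closure E \<subseteq> \<Omega>"

text \<open>Elements of \<open>C\<^sup>\<infinity>\<^sub>0(\<Omega>)\<close> are represented by their extensions by zero to the whole space.\<close>

definition test_functions :: "'a::euclidean_space set \<Rightarrow> ('a \<Rightarrow> real) set" where
  "test_functions \<Omega> = {\<phi>. smooth \<phi> \<and> compactly_inside (support_on UNIV \<phi>) \<Omega>}"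

definition bottom_spectrum :: "'a::euclidean_space set \<Rightarrow> ennreal" where
  "bottom_spectrum \<Omega> =
     (INF \<phi>\<in>{\<phi> \<in> test_functions \<Omega>. sqrt (\<integral>x. (\<phi> x)\<^sup>2 \<partial>lborel) = 1}.
        \<integral>\<^sup>+x. ennreal ((norm (gradient \<phi> x))\<^sup>2) \<partial>lborel)"

text \<open>
  The \<open>k\<close>-dimensional Hausdorff measure, normalised to agree with Lebesgue measure on
  \<open>k\<close>-dimensional subspaces. Boundedness of the covering sets has to be required explicitly,
  since \<open>diameter\<close> is unspecified on unbounded sets; empty sets must contribute \<open>0\<close> even
  for \<open>k = 0\<close>, where \<open>0 ^ 0 = 1\<close>.
\<close>

definition hausdorff_content :: "nat \<Rightarrow> real \<Rightarrow> 'a::euclidean_space set \<Rightarrow> ennreal" where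
  "hausdorff_content k \<delta> A =
     (INF U\<in>{U :: nat \<Rightarrow> 'a set. A \<subseteq> (\<Union>i. U i) \<and> (\<forall>i. bounded (U i) \<and> diameter (U i) \<le> \<delta>)}.
        \<Sum>i. if U i = {} then 0 else ennreal (unit_ball_vol (real k) * (diameter (U i) / 2) ^ k))"

definition hausdorff_measure :: "nat \<Rightarrow> 'a::euclidean_space set \<Rightarrow> ennreal" where
  "hausdorff_measure k A = (SUP \<delta>\<in>{0<..}. hausdorff_content k \<delta> A)"

text \<open>
  Near each boundary point, after a rotation taking the last coordinate axis to the direction
  \<open>e\<close>, the set is the region above the graph of a smooth function on the hyperplane orthogonal
  to \<open>e\<close>. That function is given here as the restriction of a smooth \<open>\<gamma>\<close> on the whole space
  (every smooth function on the hyperplane is one, by composing with the orthogonal projection).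
\<close>

definition smooth_boundary :: "'a::euclidean_space set \<Rightarrow> bool" where
  "smooth_boundary E \<longleftrightarrow>
     (\<forall>x\<in>frontier E. \<exists>r>0. \<exists>e \<gamma>. norm e = 1 \<and> smooth \<gamma> \<and>
        E \<inter> ball x r = {y \<in> ball x r. \<gamma> (y - (y \<bullet> e) *\<^sub>R e) < y \<bullet> e})"

definition cheeger_constant :: "'a::euclidean_space set \<Rightarrow> ennreal" where
  "cheeger_constant \<Omega> =
     (INF E\<in>{E. E \<noteq> {} \<and> open E \<and> smooth_boundary E \<and> compactly_inside E \<Omega>}.
        hausdorff_measure (DIM('a) - 1) (frontier E) / emeasure lborel E)"

definition density_index :: "'a::euclidean_space set \<Rightarrow> real \<Rightarrow> real \<Rightarrow> ennreal" where
  "density_index \<Omega> r\<^sub>0 t =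
     (INF (x, r)\<in>frontier \<Omega> \<times> {0<..r\<^sub>0}.
        ennreal ((r\<^sub>0 / r) powr t) * (emeasure lborel (ball x r - \<Omega>) / emeasure lborel (ball x r)))"

end

theory Submission
  imports Defs
begin

text \<open>
  Both quantities are compared with the inradius \<open>\<rho>\<close> of \<open>\<Omega>\<close>: the bottom of the spectrum is at
  most a constant times \<open>1 / \<rho>\<^sup>2\<close>, and the Cheeger constant is at least a constant times \<open>1 / \<rho>\<close>.

  The first bound needs only a smooth bump function supported in a ball of radius \<open>\<rho> / 2\<close> inside
  \<open>\<Omega>\<close> (\<open>bottom_spectrum_le_inradius\<close>).

  The second bound uses the measure density condition. A point of \<open>\<Omega>\<close> is within \<open>\<rho>\<close> of the
  frontier of \<open>\<Omega>\<close>, so by the density condition the ball of radius \<open>2 \<rho>\<close> around it contains a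
  fixed fraction of its volume outside \<open>\<Omega>\<close>, hence outside any competitor \<open>E\<close>. So a random
  translation of length below \<open>2 \<rho>\<close> moves each point of \<open>E\<close> out of \<open>E\<close> with probability bounded
  below. On the other hand, a translation by \<open>h\<close> moves out of \<open>E\<close> only points that cross the
  frontier of \<open>E\<close> along the way, and these occupy a volume of order \<open>\<rho>\<close> times the Hausdorff
  measure of the frontier (\<open>emeasure_displaced_le_hausdorff_content\<close>). Averaging over all \<open>h\<close> and
  exchanging the integrals gives the volume of \<open>E\<close> as at most a constant times \<open>\<rho>\<close> times the
  measure of its frontier (\<open>measure_mult_le_hausdorff_measure\<close>).

  The parameters enter only through the density condition at the scale \<open>r = min \<kappa>\<^sub>1 1 * \<rho>\<close>, which
  is at most \<open>r\<^sub>0\<close>. There the weight \<open>(r\<^sub>0 / r) powr t\<close> is at most a power of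
  \<open>\<kappa>\<^sub>2 / min \<kappa>\<^sub>1 1\<close> with exponent \<open>t\<^sub>0\<close>, or \<open>1\<close> if that ratio is smaller, and this is where
  \<open>\<kappa>\<^sub>2\<close> drops out for \<open>t\<^sub>0 = 0\<close>.
\<close>

section \<open>Bump functions and the upper bound for the spectrum\<close>

text \<open>
  The functions \<open>exp (- 1 / s) / s ^ m\<close>, extended by zero to \<open>s \<le> 0\<close>. Every power of
  \<open>1 / s\<close> is included so that the derivatives stay in the linear span of the family.
\<close>

definition flat_exp :: "nat \<Rightarrow> real \<Rightarrow> real" where
  "flat_exp m s = (if 0 < s then inverse s ^ m * exp (- inverse s) else 0)"

lemma flat_exp_tendsto_0: "(flat_exp m \<longlongrightarrow> 0) (at 0)"
proof -
  have "((\<lambda>s. inverse s ^ m / exp (inverse s)) \<longlongrightarrow> 0) (at_right (0::real))"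
    by (rule filterlim_compose[OF tendsto_power_div_exp_0 filterlim_inverse_at_top_right])
  then have "(flat_exp m \<longlongrightarrow> 0) (at_right 0)"
    by (rule Lim_transform_eventually)
      (auto simp: flat_exp_def eventually_at_filter exp_minus divide_inverse)
  moreover have "(flat_exp m \<longlongrightarrow> 0) (at_left 0)"
    by (rule Lim_transform_eventually[OF tendsto_const])
      (auto simp: flat_exp_def eventually_at_filter)
  ultimately show ?thesis
    by (simp add: filterlim_split_at)
qed

text \<open>
  At the origin the difference quotient of the \<open>m\<close>-th function is the \<open>(m + 1)\<close>-st function,
  which tends to zero; away from the origin this is the product rule.
\<close>

lemma flat_exp_has_derivative:
  "(flat_exp m has_field_derivative (flat_exp (m + 2) s - real m * flat_exp (Suc m) s)) (at s)"
proof -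
  consider "s < 0" | "s = 0" | "s > 0" by linarith
  then show ?thesis
  proof cases
    case 1
    have "((\<lambda>_. 0) has_field_derivative 0) (at s)" by simp
    then have "(flat_exp m has_field_derivative 0) (at s)"
      by (rule has_field_derivative_transform_within_open[where S="{..<0}"])
        (use 1 in \<open>auto simp: flat_exp_def\<close>)
    then show ?thesis using 1 by (simp add: flat_exp_def)
  next
    case 2
    have "flat_exp (Suc m) = (\<lambda>x. (flat_exp m x - flat_exp m 0) / (x - 0))"
      by (auto simp: flat_exp_def divide_inverse)
    then have "(flat_exp m has_field_derivative 0) (at 0)"
      unfolding has_field_derivative_iff using flat_exp_tendsto_0[of "Suc m"] by simp
    then show ?thesis using 2 by (simp add: flat_exp_def)
  next
    case 3
    have "((\<lambda>s. inverse s ^ m * exp (- inverse s)) has_field_derivative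
        real m * inverse s ^ (m - 1) * (- (inverse s * 1 * inverse s)) * exp (- inverse s)
          + exp (- inverse s) * (- (- (inverse s * 1 * inverse s))) * inverse s ^ m) (at s)"
      using 3 by (auto intro!: derivative_eq_intros simp: mult_ac)
    also have "real m * t ^ (m - 1) * (- (t * 1 * t)) * e + e * (- (- (t * 1 * t))) * t ^ m
        = t ^ (m + 2) * e - real m * (t ^ Suc m * e)" for t e :: real
      by (cases m) (simp_all add: algebra_simps)
    finally have "((\<lambda>s. inverse s ^ m * exp (- inverse s)) has_field_derivative
        (flat_exp (m + 2) s - real m * flat_exp (Suc m) s)) (at s)"
      using 3 by (simp only: flat_exp_def if_True)
    then show ?thesis
      by (rule has_field_derivative_transform_within_open[where S="{0<..}"])
        (use 3 in \<open>auto simp: flat_exp_def\<close>)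
  qed
qed

lemma flat_exp_2_bounds: "0 \<le> flat_exp 2 s" "flat_exp 2 s \<le> 2"
proof -
  have "t\<^sup>2 * exp (- t) \<le> 2" if "0 < t" for t :: real
  proof -
    have "t\<^sup>2 / 2 \<le> exp t"
      using exp_lower_Taylor_quadratic[of t] that by linarith
    then have "t\<^sup>2 * exp (- t) \<le> 2 * exp t * exp (- t)" by (intro mult_right_mono) auto
    also have "\<dots> = 2" by (simp add: exp_minus)
    finally show ?thesis .
  qed
  then show "flat_exp 2 s \<le> 2" by (simp add: flat_exp_def)
qed (auto simp: flat_exp_def)

text \<open>
  Smoothness is defined through iterated partial derivatives, so it holds for every member of a
  class of differentiable functions that contains all partial derivatives of its members. This
  algebra is such a class, generated by what differentiating the bump function
  \<open>exp (- 1 / (1 - \<bar>x - a\<bar>\<^sup>2 / r\<^sup>2))\<close> produces.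
\<close>

inductive_set bump_algebra :: "'a::euclidean_space \<Rightarrow> real \<Rightarrow> ('a \<Rightarrow> real) set" for a r where
  const: "(\<lambda>_. c) \<in> bump_algebra a r"
| coordinate: "(\<lambda>x. x \<bullet> v) \<in> bump_algebra a r"
| bump: "(\<lambda>x. flat_exp m (1 - ((x - a) \<bullet> (x - a)) / r\<^sup>2)) \<in> bump_algebra a r"
| add: "f \<in> bump_algebra a r \<Longrightarrow> g \<in> bump_algebra a r \<Longrightarrow> (\<lambda>x. f x + g x) \<in> bump_algebra a r"
| mult: "f \<in> bump_algebra a r \<Longrightarrow> g \<in> bump_algebra a r \<Longrightarrow> (\<lambda>x. f x * g x) \<in> bump_algebra a r"

lemma bump_has_derivative:
  "((\<lambda>x. flat_exp m (1 - ((x - a) \<bullet> (x - a)) / r\<^sup>2)) has_derivative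
    (\<lambda>h. (flat_exp (m + 2) (1 - ((x - a) \<bullet> (x - a)) / r\<^sup>2)
            - real m * flat_exp (Suc m) (1 - ((x - a) \<bullet> (x - a)) / r\<^sup>2))
          * (- 2 / r\<^sup>2 * ((x - a) \<bullet> h)))) (at x)"
proof -
  have "((\<lambda>x. 1 - ((x - a) \<bullet> (x - a)) / r\<^sup>2) has_derivative
      (\<lambda>h. - 2 / r\<^sup>2 * ((x - a) \<bullet> h))) (at x)"
    unfolding divide_inverse
    by (auto intro!: derivative_eq_intros simp: inner_commute)
  then show ?thesis
    by (rule has_derivative_compose[OF _ flat_exp_has_derivative[unfolded has_field_derivative_def]])
qed

lemma bump_algebra_derivative:
  assumes "f \<in> bump_algebra a r"
  shows "\<exists>D. (\<forall>x. (f has_derivative D x) (at x)) \<and> (\<forall>v. (\<lambda>x. D x v) \<in> bump_algebra a r)"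
  using assms
proof induction
  case (const c)
  then show ?case
    by (intro exI[of _ "\<lambda>_ _. 0"]) (auto intro: bump_algebra.const)
next
  case (coordinate v)
  then show ?case
    by (intro exI[of _ "\<lambda>_ h. h \<bullet> v"])
      (auto intro: bump_algebra.const intro!: derivative_eq_intros)
next
  case (bump m)
  let ?u = "\<lambda>x. 1 - ((x - a) \<bullet> (x - a)) / r\<^sup>2"
  have "(\<lambda>x. (flat_exp (m + 2) (?u x) + (- real m) * flat_exp (Suc m) (?u x))
           * (- 2 / r\<^sup>2 * (x \<bullet> v + (- (a \<bullet> v))))) \<in> bump_algebra a r" for v
    by (intro bump_algebra.intros)
  then show ?case
    using bump_has_derivative[of m a r]
    by (intro exI[of _ "\<lambda>x h. (flat_exp (m + 2) (?u x) - real m * flat_exp (Suc m) (?u x))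
          * (- 2 / r\<^sup>2 * ((x - a) \<bullet> h))"]) (simp add: inner_diff_left)
next
  case (add f g)
  then obtain D D' where
      D: "\<forall>x. (f has_derivative D x) (at x)" "\<forall>v. (\<lambda>x. D x v) \<in> bump_algebra a r"
    and D': "\<forall>x. (g has_derivative D' x) (at x)" "\<forall>v. (\<lambda>x. D' x v) \<in> bump_algebra a r"
    by blast
  then show ?case
    by (intro exI[of _ "\<lambda>x h. D x h + D' x h"])
      (auto intro!: has_derivative_add bump_algebra.add)
next
  case (mult f g)
  then obtain D D' where
      D: "\<forall>x. (f has_derivative D x) (at x)" "\<forall>v. (\<lambda>x. D x v) \<in> bump_algebra a r"
    and D': "\<forall>x. (g has_derivative D' x) (at x)" "\<forall>v. (\<lambda>x. D' x v) \<in> bump_algebra a r"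
    by blast
  with mult.hyps show ?case
    by (intro exI[of _ "\<lambda>x h. f x * D' x h + D x h * g x"])
      (auto intro!: has_derivative_mult bump_algebra.add bump_algebra.mult)
qed

lemma bump_algebra_smooth:
  assumes "f \<in> bump_algebra a r"
  shows "smooth f"
proof -
  have "C_k k f" if "f \<in> bump_algebra a r" for k f
    using that
  proof (induction k arbitrary: f)
    case 0
    then obtain D where "\<forall>x. (f has_derivative D x) (at x)"
      using bump_algebra_derivative by blast
    then show ?case
      by (auto intro!: continuous_at_imp_continuous_on has_derivative_continuous)
  next
    case (Suc k)
    obtain D where D: "\<forall>x. (f has_derivative D x) (at x)" "\<forall>v. (\<lambda>x. D x v) \<in> bump_algebra a r"
      using bump_algebra_derivative[OF Suc.prems] by blast
    then have "frechet_derivative f (at x) = D x" for x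
      by (metis frechet_derivative_at)
    with D Suc.IH show ?case
      by (auto simp: differentiable_def)
  qed
  with assms show ?thesis by (simp add: smooth_def)
qed

lemma gradient_eqI:
  fixes f :: "'a::euclidean_space \<Rightarrow> real"
  assumes "(f has_derivative (\<lambda>h. w \<bullet> h)) (at x)"
  shows "gradient f x = w"
  using frechet_derivative_at[OF assms, symmetric]
  by (simp add: gradient_def euclidean_representation)

text \<open>
  The test function is the bump supported on the ball, normalised in \<open>L\<^sup>2\<close>. Its gradient is at
  most \<open>4 / r\<close> times the normalising factor because \<open>exp (- 1 / s) / s\<^sup>2 \<le> 2\<close>, and its norm is
  controlled from below on the concentric ball of half the radius. Both bounds are multiples of
  the volume of the ball, which cancels.
\<close>

lemma bottom_spectrum_le_of_cball:
  fixes a :: "'a::euclidean_space"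
  assumes r: "0 < r" and sub: "cball a r \<subseteq> \<Omega>"
  shows "bottom_spectrum \<Omega> \<le> ennreal (16 * 2 ^ DIM('a) * exp (8/3) / r\<^sup>2)"
proof -
  let ?n = "DIM('a)"
  define u where "u x = 1 - ((x - a) \<bullet> (x - a)) / r\<^sup>2" for x
  define \<psi> where "\<psi> x = flat_exp 0 (u x)" for x
  have u_pos: "0 < u x \<longleftrightarrow> x \<in> ball a r" for x
  proof -
    have "0 < u x \<longleftrightarrow> (norm (x - a))\<^sup>2 < r\<^sup>2"
      using r by (simp add: u_def dot_square_norm)
    also have "\<dots> \<longleftrightarrow> norm (x - a) < r"
      using r by (metis power2_less_imp_less power_strict_mono less_eq_real_def norm_ge_zero zero_less_numeral)
    finally show ?thesis by (simp add: dist_norm norm_minus_commute)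
  qed
  have alg: "(\<lambda>x. c * \<psi> x) \<in> bump_algebra a r" for c
    unfolding \<psi>_def u_def by (intro bump_algebra.intros)
  have cont: "continuous_on UNIV \<psi>"
    using bump_algebra_smooth[OF alg[of 1]] by (simp add: smooth_def) (metis C_k.simps(1))
  have \<psi>_le: "\<bar>\<psi> x\<bar> \<le> indicator (cball a r) x" for x
    using u_pos[of x] by (auto simp: \<psi>_def flat_exp_def indicator_def)
  have fin: "emeasure lborel (cball a r) < \<infinity>"
    by (rule emeasure_lborel_cball_finite)
  have int: "integrable lborel (\<lambda>x. (\<psi> x)\<^sup>2)"
  proof (rule Bochner_Integration.integrable_bound)
    show "integrable lborel (indicator (cball a r) :: 'a \<Rightarrow> real)"
      using fin by (intro integrable_real_indicator) auto
    show "(\<lambda>x. (\<psi> x)\<^sup>2) \<in> borel_measurable lborel"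
      using borel_measurable_continuous_onI[OF cont] by measurable
    show "AE x in lborel. norm ((\<psi> x)\<^sup>2) \<le> norm (indicator (cball a r) x :: real)"
    proof (intro AE_I2)
      fix x
      have "\<bar>\<psi> x\<bar>\<^sup>2 \<le> (indicator (cball a r) x)\<^sup>2"
        by (intro power_mono \<psi>_le) auto
      then show "norm ((\<psi> x)\<^sup>2) \<le> norm (indicator (cball a r) x :: real)"
        by (cases "x \<in> cball a r") auto
    qed
  qed
  define I where "I = (\<integral>x. (\<psi> x)\<^sup>2 \<partial>lborel)"
  (* On the half ball the argument of the bump is at least 3/4, and exp (- 4/3) squared is
     exp (- 8/3). *)
  have I_ge: "exp (-8/3) * unit_ball_vol ?n * (r/2) ^ ?n \<le> I"
  proof -
    have "exp (-8/3) * unit_ball_vol ?n * (r/2) ^ ?n = (\<integral>x. exp (-8/3) * indicator (ball a (r/2)) x \<partial>lborel)"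
      using r by (simp add: content_ball)
    also have "\<dots> \<le> I"
      unfolding I_def
    proof (rule integral_mono[OF _ int])
      show "integrable lborel (\<lambda>x. exp (-8/3) * indicator (ball a (r/2)) x :: real)"
        using emeasure_lborel_ball_finite by (intro integrable_mult_right integrable_real_indicator) auto
      fix x
      show "exp (-8/3) * indicator (ball a (r/2)) x \<le> (\<psi> x)\<^sup>2"
      proof (cases "x \<in> ball a (r/2)")
        case True
        then have "norm (x - a) \<le> r/2" by (simp add: dist_norm norm_minus_commute)
        then have "(norm (x - a))\<^sup>2 \<le> (r/2)\<^sup>2" by (intro power_mono) auto
        then have "3/4 \<le> u x"
          using r by (simp add: u_def dot_square_norm field_simps power2_eq_square)
        moreover from this have "- inverse (u x) \<ge> -4/3" by (simp add: field_simps)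
        ultimately have "exp (-4/3) \<le> \<psi> x" by (simp add: \<psi>_def flat_exp_def)
        then have "(exp (-4/3))\<^sup>2 \<le> (\<psi> x)\<^sup>2" by (intro power_mono) auto
        moreover have "(exp (-4/3::real))\<^sup>2 = exp (-8/3)"
          by (simp add: power2_eq_square flip: exp_add)
        ultimately show ?thesis using True by (simp only: indicator_simps mult_1_right)
      qed simp
    qed
    finally show ?thesis .
  qed
  have I_pos: "0 < I"
  proof -
    have "0 < exp (-8/3) * unit_ball_vol ?n * (r/2) ^ ?n"
      using r by (intro mult_pos_pos zero_less_power) auto
    with I_ge show ?thesis by linarith
  qed
  define \<phi> where "\<phi> x = (1 / sqrt I) * \<psi> x" for x
  have "\<phi> x \<noteq> 0 \<longleftrightarrow> x \<in> ball a r" for x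
    unfolding u_pos[symmetric] using I_pos by (simp add: \<phi>_def \<psi>_def flat_exp_def)
  then have "support_on UNIV \<phi> = ball a r"
    unfolding support_on_def by blast
  then have test: "\<phi> \<in> test_functions \<Omega>"
    using r sub bump_algebra_smooth[OF alg[of "1 / sqrt I"]]
    unfolding test_functions_def compactly_inside_def \<phi>_def[abs_def, symmetric] by simp
  have "(\<integral>x. (\<phi> x)\<^sup>2 \<partial>lborel) = 1"
    using I_pos
    by (simp only: \<phi>_def power_mult_distrib power_divide integral_mult_right_zero flip: I_def) simp
  then have "bottom_spectrum \<Omega> \<le> (\<integral>\<^sup>+x. ennreal ((norm (gradient \<phi> x))\<^sup>2) \<partial>lborel)"
    unfolding bottom_spectrum_def using test by (intro INF_lower) auto
  also have "\<dots> \<le> (\<integral>\<^sup>+x. ennreal (16 / (I * r\<^sup>2)) * indicator (cball a r) x \<partial>lborel)"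
  proof (rule nn_integral_mono)
    fix x
    define w where "w = (1 / sqrt I * (flat_exp 2 (u x) * (- 2 / r\<^sup>2))) *\<^sub>R (x - a)"
    have "(\<phi> has_derivative (\<lambda>h. w \<bullet> h)) (at x)"
      using has_derivative_mult_right[OF bump_has_derivative[of 0 a r x], of "1 / sqrt I"]
      by (simp add: \<phi>_def[abs_def] \<psi>_def u_def w_def numeral_2_eq_2 mult.assoc)
    then have grad: "gradient \<phi> x = w" by (rule gradient_eqI)
    show "ennreal ((norm (gradient \<phi> x))\<^sup>2) \<le> ennreal (16 / (I * r\<^sup>2)) * indicator (cball a r) x"
    proof (cases "x \<in> ball a r")
      case True
      have "norm w = 1 / sqrt I * (flat_exp 2 (u x) * (2 / r\<^sup>2)) * norm (x - a)"
        using I_pos flat_exp_2_bounds(1)[of "u x"] by (simp add: w_def abs_mult)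
      also have "\<dots> \<le> 1 / sqrt I * (2 * (2 / r\<^sup>2)) * r"
        using True I_pos flat_exp_2_bounds[of "u x"] r
        by (intro mult_mono mult_nonneg_nonneg) (auto simp: dist_norm norm_minus_commute)
      also have "\<dots> = 4 / (sqrt I * r)" using r by (simp add: power2_eq_square)
      finally have "(norm w)\<^sup>2 \<le> (4 / (sqrt I * r))\<^sup>2" by (intro power_mono) auto
      also have "\<dots> = 16 / (I * r\<^sup>2)"
        using I_pos by (simp add: power_divide power_mult_distrib)
      finally show ?thesis
        using True by (auto simp: grad intro!: ennreal_leI)
    next
      case False
      then have "w = 0" using u_pos[of x] by (simp add: w_def flat_exp_def)
      then show ?thesis by (simp add: grad)
    qed
  qed
  also have "\<dots> = ennreal (16 / (I * r\<^sup>2)) * ennreal (unit_ball_vol ?n * r ^ ?n)"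
    using r by (simp add: nn_integral_cmult_indicator emeasure_cball)
  also have "\<dots> = ennreal (16 / (I * r\<^sup>2) * (unit_ball_vol ?n * r ^ ?n))"
    using I_pos by (intro ennreal_mult'[symmetric]) auto
  also have "\<dots> \<le> ennreal (16 * 2 ^ ?n * exp (8/3) / r\<^sup>2)"
  proof (rule ennreal_leI)
    have "exp (8/3) * exp (-8/3) = (1::real)" by (simp flip: exp_add)
    then have "unit_ball_vol ?n * r ^ ?n
        = 2 ^ ?n * exp (8/3) * (exp (-8/3) * unit_ball_vol ?n * (r/2) ^ ?n)"
      unfolding power_divide by (simp only: mult_ac times_divide_eq_right) simp
    also have "\<dots> \<le> 2 ^ ?n * exp (8/3) * I"
      using I_ge by (intro mult_left_mono) auto
    finally have "16 / (I * r\<^sup>2) * (unit_ball_vol ?n * r ^ ?n) \<le> 16 / (I * r\<^sup>2) * (2 ^ ?n * exp (8/3) * I)"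
      using I_pos by (intro mult_left_mono) auto
    also have "\<dots> = 16 * 2 ^ ?n * exp (8/3) / r\<^sup>2"
      using I_pos by simp
    finally show "16 / (I * r\<^sup>2) * (unit_ball_vol ?n * r ^ ?n) \<le> 16 * 2 ^ ?n * exp (8/3) / r\<^sup>2" .
  qed
  finally show ?thesis .
qed

lemma bottom_spectrum_le_inradius:
  fixes \<Omega> :: "'a::euclidean_space set"
  assumes "inradius \<Omega> = ennreal \<rho>" "0 < \<rho>"
  shows "bottom_spectrum \<Omega> \<le> ennreal (64 * 2 ^ DIM('a) * exp (8/3) / \<rho>\<^sup>2)"
proof -
  have "ennreal (\<rho> / 2) < inradius \<Omega>" using assms by (simp add: ennreal_less_iff)
  then obtain x r where xr: "ennreal (\<rho> / 2) < ennreal r" "ball x r \<subseteq> \<Omega>"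
    unfolding inradius_def less_Sup_iff by auto
  then have "\<rho> / 2 < r" using assms by (simp add: ennreal_less_iff)
  then have "cball x (\<rho> / 2) \<subseteq> \<Omega>" using xr(2) by (force simp: subset_iff)
  then show ?thesis
    using bottom_spectrum_le_of_cball[of "\<rho> / 2" x \<Omega>] assms by (simp add: power_divide mult_ac)
qed

section \<open>Translations and the measure of the frontier\<close>

text \<open>
  A set of diameter \<open>d\<close>, moved along a segment of length at most \<open>R\<close>, stays within \<open>2 d\<close> of
  points spaced by \<open>d\<close> along that segment. At most \<open>R / d + 1\<close> such points are needed, whence a
  volume of order \<open>d\<^sup>N\<^sup>-\<^sup>1 (R + d)\<close>. The closure of the set is moved, so that the swept set is
  compact and hence measurable.
\<close>

lemma emeasure_swept_set_le:
  fixes U :: "'a::euclidean_space set" and h :: 'a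
  assumes "bounded U" "norm h \<le> R" "0 < R" "U \<noteq> {}"
  defines "V \<equiv> (\<lambda>(u, s). u + s *\<^sub>R h) ` (closure U \<times> {0..1::real})"
  shows "V \<in> sets borel"
    and "emeasure lborel V \<le>
      ennreal (unit_ball_vol DIM('a) * 2 ^ DIM('a) * diameter U ^ (DIM('a) - 1) * (R + diameter U))"
proof -
  let ?n = "DIM('a)"
  let ?f = "\<lambda>d. unit_ball_vol ?n * 2 ^ ?n * d ^ (?n - 1) * (R + d)"
  have "compact V"
    unfolding V_def split_def using assms(1)
    by (intro compact_continuous_image compact_Times continuous_intros) (auto simp: compact_closure)
  then show meas: "V \<in> sets borel" by (simp add: borel_compact)
  obtain u\<^sub>0 where u0: "u\<^sub>0 \<in> U" using assms(4) by auto
  (* The balls of radius 2 d require d > 0, which the diameter of a one-point set violates. Hence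
     the bound is proved for every d above the diameter, and then d decreases to the diameter. *)
  have bound: "emeasure lborel V \<le> ennreal (?f d)" if d: "diameter U < d" for d
  proof -
    have "0 \<le> diameter U" using assms(1) by (rule diameter_ge_0)
    then have d0: "0 < d" using d by simp
    define p where "p k = u\<^sub>0 + (real k * d / R) *\<^sub>R h" for k
    define m where "m = nat \<lfloor>R / d\<rfloor>"
    have "V \<subseteq> (\<Union>k\<in>{..m}. cball (p k) (2 * d))"
    proof
      fix v assume "v \<in> V"
      then obtain u s where us: "u \<in> closure U" "0 \<le> s" "s \<le> 1" "v = u + s *\<^sub>R h"
        by (auto simp: V_def)
      define k where "k = nat \<lfloor>s * R / d\<rfloor>"
      have nn: "0 \<le> s * R / d" using us d0 assms(3) by simp
      have "k \<le> m"
        unfolding k_def m_def using us d0 assms(3)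
        by (intro nat_mono floor_mono divide_right_mono) (auto simp: mult_left_le_one_le)
      have k: "real k \<le> s * R / d" "s * R / d \<le> real k + 1"
        unfolding k_def using nn by linarith+
      have "real k * d / R \<le> s" "s \<le> real k * d / R + d / R"
        using k d0 assms(3) by (simp_all add: field_simps)
      then have "\<bar>s - real k * d / R\<bar> \<le> d / R" by linarith
      then have "\<bar>s - real k * d / R\<bar> * norm h \<le> d / R * R"
        using assms d0 by (intro mult_mono) auto
      then have 1: "norm ((s - real k * d / R) *\<^sub>R h) \<le> d" using assms(3) by simp
      have "dist u u\<^sub>0 \<le> diameter (closure U)"
        using us u0 assms(1) by (intro diameter_bounded_bound) (auto simp: closure_subset[THEN subsetD])
      then have 2: "norm (u - u\<^sub>0) \<le> d" using d assms(1) by (simp add: diameter_closure dist_norm)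
      have "v - p k = (u - u\<^sub>0) + (s - real k * d / R) *\<^sub>R h"
        by (simp add: us p_def algebra_simps)
      then have "norm (v - p k) \<le> 2 * d"
        using norm_triangle_ineq[of "u - u\<^sub>0" "(s - real k * d / R) *\<^sub>R h"] 1 2 by simp
      then show "v \<in> (\<Union>k\<in>{..m}. cball (p k) (2 * d))"
        using \<open>k \<le> m\<close> by (auto simp: dist_norm norm_minus_commute)
    qed
    then have "emeasure lborel V \<le> emeasure lborel (\<Union>k\<in>{..m}. cball (p k) (2 * d))"
      by (intro emeasure_mono) auto
    also have "\<dots> \<le> (\<Sum>k\<in>{..m}. emeasure lborel (cball (p k) (2 * d)))"
      by (intro emeasure_subadditive_finite) auto
    also have "\<dots> = of_nat (Suc m) * ennreal (unit_ball_vol ?n * (2 * d) ^ ?n)"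
      using d0 by (simp add: emeasure_cball)
    also have "\<dots> = ennreal (real (Suc m) * (unit_ball_vol ?n * (2 * d) ^ ?n))"
      using d0 by (simp add: ennreal_mult' flip: ennreal_of_nat_eq_real_of_nat)
    also have "\<dots> \<le> ennreal ((R / d + 1) * (unit_ball_vol ?n * (2 * d) ^ ?n))"
    proof (intro ennreal_leI mult_right_mono)
      have "0 \<le> R / d" using assms d0 by simp
      then show "real (Suc m) \<le> R / d + 1" unfolding m_def by simp
    qed (use d0 in auto)
    also have "(R / d + 1) * (unit_ball_vol ?n * (2 * d) ^ ?n) = ?f d"
    proof -
      have "d ^ ?n = d ^ (?n - 1) * d" by (simp add: power_eq_if)
      then show ?thesis using d0 by (simp add: field_simps power_mult_distrib)
    qed
    finally show ?thesis .
  qed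
  show "emeasure lborel V \<le> ennreal (?f (diameter U))"
  proof (rule tendsto_lowerbound)
    show "((\<lambda>d. ennreal (?f d)) \<longlongrightarrow> ennreal (?f (diameter U))) (at_right (diameter U))"
      by (intro tendsto_ennrealI tendsto_intros)
    show "\<forall>\<^sub>F d in at_right (diameter U). emeasure lborel V \<le> ennreal (?f d)"
      using bound by (auto simp: eventually_at_filter)
  qed simp
qed

lemma ennreal_mult_divide_cancel_left: "0 < k \<Longrightarrow> ennreal k * b / ennreal k = b"
  by (simp add: ennreal_mult_divide_eq mult.commute)

lemma le_ennreal_mult_INF:
  fixes f :: "'b \<Rightarrow> ennreal"
  assumes "0 < k" and le: "\<And>i. i \<in> I \<Longrightarrow> a \<le> ennreal k * f i"
  shows "a \<le> ennreal k * (INF i\<in>I. f i)"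
proof -
  note cancel = ennreal_mult_divide_cancel_left[OF assms(1)]
  have "a / ennreal k \<le> (INF i\<in>I. f i)"
    using divide_right_mono_ennreal[OF le, of _ "ennreal k"]
    by (intro INF_greatest) (simp only: cancel)
  then have "ennreal k * (a / ennreal k) \<le> ennreal k * (INF i\<in>I. f i)"
    by (intro mult_left_mono) auto
  then show ?thesis
    using cancel[of a] by (simp add: ennreal_times_divide)
qed

text \<open>
  The ratio between the volume bound for a swept set and the contribution
  \<open>\<omega>\<^sub>N\<^sub>-\<^sub>1 (d / 2)\<^sup>N\<^sup>-\<^sup>1\<close> of a covering set to the Hausdorff content, per unit of the length
  \<open>R + d\<close>.
\<close>

definition displacement_const :: "nat \<Rightarrow> real" where
  "displacement_const n =
     unit_ball_vol (real n) * 2 ^ n * 2 ^ (n - 1) / unit_ball_vol (real (n - 1))"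

lemma displacement_const_pos: "0 < displacement_const n"
  by (simp only: displacement_const_def) (intro mult_pos_pos divide_pos_pos; simp)

text \<open>
  A point of \<open>E\<close> that the translation by \<open>h\<close> carries out of \<open>E\<close> crosses the frontier on the way,
  so it lies in the frontier swept along \<open>- h\<close>. Covering the frontier and sweeping each piece
  bounds the volume of these points by the Hausdorff content.
\<close>

lemma emeasure_displaced_le_hausdorff_content:
  fixes E :: "'a::euclidean_space set" and h :: 'a
  assumes "open E" "norm h \<le> R" "0 < R" "0 < \<delta>"
  shows "emeasure lborel {x \<in> E. x + h \<notin> E} \<le>
    ennreal (displacement_const DIM('a) * (R + \<delta>))
      * hausdorff_content (DIM('a) - 1) \<delta> (frontier E)"
    (is "?L \<le> ennreal ?K * _")
proof -
  let ?n = "DIM('a)"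
  let ?\<omega> = "unit_ball_vol (real (?n - 1))"
  have \<omega>: "0 < ?\<omega>" by simp
  have cover: "?L \<le> ennreal ?K * (\<Sum>i. if U i = {} then 0 else ennreal (?\<omega> * (diameter (U i) / 2) ^ (?n - 1)))"
    if U: "frontier E \<subseteq> (\<Union>i. U i)" "\<And>i. bounded (U i)" "\<And>i. diameter (U i) \<le> \<delta>" for U :: "nat \<Rightarrow> 'a set"
  proof -
    define V where "V i = (\<lambda>(u, s). u + s *\<^sub>R (- h)) ` (closure (U i) \<times> {0..1::real})" for i
    have V_empty: "V i = {}" if "U i = {}" for i using that by (simp add: V_def)
    have V_meas: "V i \<in> sets borel" for i
      using emeasure_swept_set_le(1)[of "U i" "-h" R] U assms V_empty[of i]
      by (cases "U i = {}") (auto simp: V_def)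
    have "{x \<in> E. x + h \<notin> E} \<subseteq> (\<Union>i. V i)"
    proof
      fix x assume "x \<in> {x \<in> E. x + h \<notin> E}"
      then have "closed_segment x (x + h) \<inter> frontier E \<noteq> {}"
        by (intro connected_Int_frontier) auto
      then obtain s where s: "0 \<le> s" "s \<le> 1" "x + s *\<^sub>R h \<in> frontier E"
        by (auto simp: closed_segment_def algebra_simps)
      then obtain i where "x + s *\<^sub>R h \<in> U i" using U(1) by blast
      then have "(x + s *\<^sub>R h, s) \<in> closure (U i) \<times> {0..1}"
        using s closure_subset by auto
      then have "x \<in> V i" unfolding V_def by (force intro: rev_image_eqI)
      then show "x \<in> (\<Union>i. V i)" by blast
    qed
    then have "?L \<le> emeasure lborel (\<Union>i. V i)"
      using V_meas by (intro emeasure_mono) auto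
    also have "\<dots> \<le> (\<Sum>i. emeasure lborel (V i))"
      using V_meas by (intro emeasure_subadditive_countably) auto
    also have "\<dots> \<le> (\<Sum>i. ennreal ?K * (if U i = {} then 0 else ennreal (?\<omega> * (diameter (U i) / 2) ^ (?n - 1))))"
    proof (intro suminf_le)
      fix i
      show "emeasure lborel (V i) \<le> ennreal ?K * (if U i = {} then 0 else ennreal (?\<omega> * (diameter (U i) / 2) ^ (?n - 1)))"
      proof (cases "U i = {}")
        case False
        let ?d = "diameter (U i)"
        have d: "0 \<le> ?d" using U(2) by (rule diameter_ge_0)
        have "emeasure lborel (V i) \<le> ennreal (unit_ball_vol ?n * 2 ^ ?n * ?d ^ (?n - 1) * (R + ?d))"
          unfolding V_def using U assms False by (intro emeasure_swept_set_le(2)) auto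
        also have "\<dots> \<le> ennreal (unit_ball_vol ?n * 2 ^ ?n * ?d ^ (?n - 1) * (R + \<delta>))"
          using U(3)[of i] d by (intro ennreal_leI mult_left_mono mult_nonneg_nonneg) auto
        also have "unit_ball_vol ?n * 2 ^ ?n * ?d ^ (?n - 1) * (R + \<delta>) = ?K * (?\<omega> * (?d / 2) ^ (?n - 1))"
        proof -
          have "a * b = a * 2 ^ (?n - 1) / w * c * (w * (?d / 2) ^ (?n - 1))"
            if "w \<noteq> 0" "b = ?d ^ (?n - 1) * c" for a b c w :: real
            using that by (simp add: power_divide)
          from this[of ?\<omega>] \<omega> show ?thesis
            by (simp only: displacement_const_def mult_ac) simp
        qed
        also have "ennreal \<dots> = ennreal ?K * ennreal (?\<omega> * (?d / 2) ^ (?n - 1))"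
          using d \<omega> by (intro ennreal_mult'') auto
        finally show ?thesis using False by simp
      qed (simp add: V_empty)
    qed auto
    also have "\<dots> = ennreal ?K * (\<Sum>i. if U i = {} then 0 else ennreal (?\<omega> * (diameter (U i) / 2) ^ (?n - 1)))"
      by (rule ennreal_suminf_cmult)
    finally show ?thesis .
  qed
  have "0 < ?K" using assms displacement_const_pos by (intro mult_pos_pos) auto
  then show ?thesis
    unfolding hausdorff_content_def by (rule le_ennreal_mult_INF) (use cover in auto)
qed

text \<open>
  An isoperimetric inequality for sets that leave a definite volume \<open>m\<close> uncovered in every ball
  of radius \<open>R\<close> centred in them. Both sides estimate the volume of the set of pairs \<open>(x, h)\<close> with
  \<open>x \<in> E\<close>, \<open>\<bar>h\<bar> < R\<close> and \<open>x + h \<notin> E\<close>: the slices with \<open>x\<close> fixed have volume at least \<open>m\<close>,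
  those with \<open>h\<close> fixed are bounded through the frontier.
\<close>

lemma measure_mult_le_hausdorff_measure:
  fixes E :: "'a::euclidean_space set"
  assumes E: "open E" and R: "0 < R"
    and dens: "\<And>x. x \<in> E \<Longrightarrow> ennreal m \<le> emeasure lborel (ball x R - E)"
  shows "ennreal m * emeasure lborel E \<le>
    ennreal (unit_ball_vol DIM('a) * R ^ DIM('a)) *
    (ennreal (displacement_const DIM('a) * (2 * R))
      * hausdorff_measure (DIM('a) - 1) (frontier E))"
    (is "_ \<le> ennreal ?B * ?H")
proof -
  have EB: "E \<in> sets borel" using E by simp
  define S :: "('a \<times> 'a) set" where "S = {p. fst p \<in> E \<and> snd p \<in> ball 0 R \<and> fst p + snd p \<notin> E}"
  have S: "S \<in> sets (lborel \<Otimes>\<^sub>M lborel)"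
  proof -
    have "S = (fst -` E \<inter> snd -` ball 0 R) - (\<lambda>p. fst p + snd p) -` E"
      by (auto simp: S_def)
    moreover have "open (fst -` E :: ('a \<times> 'a) set)" "open (snd -` ball 0 R :: ('a \<times> 'a) set)"
      "open ((\<lambda>p. fst p + snd p) -` E :: ('a \<times> 'a) set)"
      using E by (auto intro!: open_vimage continuous_intros)
    ultimately have "S \<in> sets (borel :: ('a \<times> 'a) measure)" by auto
    then show ?thesis by (metis lborel_prod sets_lborel)
  qed
  have "ennreal m * emeasure lborel E = (\<integral>\<^sup>+x. ennreal m * indicator E x \<partial>lborel)"
    using EB by (simp add: nn_integral_cmult_indicator)
  also have "\<dots> \<le> (\<integral>\<^sup>+x. emeasure lborel (Pair x -` S) \<partial>lborel)"
  proof (rule nn_integral_mono)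
    fix x
    show "ennreal m * indicator E x \<le> emeasure lborel (Pair x -` S)"
    proof (cases "x \<in> E")
      case True
      have "ball x R - E \<in> sets borel" using EB by auto
      then have "emeasure lborel (ball x R - E) = emeasure lborel ((+) x -` (ball x R - E))"
        by (subst lborel_distr_plus[of x, symmetric]) (simp add: emeasure_distr)
      also have "(+) x -` (ball x R - E) = Pair x -` S"
        using True by (auto simp: S_def dist_norm)
      finally show ?thesis using dens[OF True] True by simp
    qed simp
  qed
  also have "\<dots> = emeasure (lborel \<Otimes>\<^sub>M lborel) S"
    by (rule lborel.emeasure_pair_measure_alt[symmetric, OF S])
  also have "\<dots> = (\<integral>\<^sup>+h. emeasure lborel ((\<lambda>x. (x, h)) -` S) \<partial>lborel)"
    by (rule lborel_pair.emeasure_pair_measure_alt2[OF S])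
  also have "\<dots> \<le> (\<integral>\<^sup>+h. ?H * indicator (ball (0::'a) R) h \<partial>lborel)"
  proof (rule nn_integral_mono)
    fix h :: 'a
    show "emeasure lborel ((\<lambda>x. (x, h)) -` S) \<le> ?H * indicator (ball 0 R) h"
    proof (cases "h \<in> ball 0 R")
      case True
      then have "(\<lambda>x. (x, h)) -` S = {x \<in> E. x + h \<notin> E}"
        by (auto simp: S_def)
      also have "emeasure lborel \<dots> \<le> 
        ennreal (displacement_const DIM('a) * (R + R))
      * hausdorff_content (DIM('a) - 1) R (frontier E)"
        using True E R by (intro emeasure_displaced_le_hausdorff_content) auto
      also have "\<dots> \<le> ?H"
        using R by (auto intro!: mult_left_mono SUP_upper simp: hausdorff_measure_def simp flip: mult_2)
      finally show ?thesis using True by simp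
    qed (auto simp: S_def)
  qed
  also have "\<dots> = ennreal ?B * ?H"
    using R by (subst nn_integral_cmult_indicator) (auto simp: emeasure_ball mult.commute)
  finally show ?thesis .
qed

section \<open>The lower bound for the Cheeger constant\<close>

lemma ball_subset_imp_le_inradius:
  assumes "ball x r \<subseteq> \<Omega>" "0 < r"
  shows "ennreal r \<le> inradius \<Omega>"
  unfolding inradius_def using assms by (intro Sup_upper) auto

lemma exists_frontier_point_within_inradius:
  fixes \<Omega> :: "'a::euclidean_space set"
  assumes "open \<Omega>" "x \<in> \<Omega>" "inradius \<Omega> \<le> ennreal \<rho>" "0 < \<rho>"
  obtains y where "y \<in> frontier \<Omega>" "dist x y \<le> \<rho>"
proof -
  have "\<Omega> \<noteq> UNIV"
  proof
    assume "\<Omega> = UNIV"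
    then have "ennreal (\<rho> + 1) \<le> ennreal \<rho>"
      using assms(4) by (intro order_trans[OF ball_subset_imp_le_inradius[of x] assms(3)]) auto
    then show False using assms(4) by (simp add: ennreal_le_iff del: ennreal_plus)
  qed
  then obtain y where y: "y \<in> - \<Omega>" "\<And>z. z \<in> - \<Omega> \<Longrightarrow> dist x y \<le> dist x z"
    using distance_attains_inf[of "- \<Omega>" x] assms(1) by (auto simp: closed_def)
  then have d: "0 < dist x y" using assms(2) by auto
  have sub: "ball x (dist x y) \<subseteq> \<Omega>"
    using y(2) by force
  have "y \<in> closure (ball x (dist x y))" using d by simp
  then have "y \<in> closure \<Omega>" using closure_mono[OF sub] by blast
  then have "y \<in> frontier \<Omega>" using y(1) assms(1) by (simp add: frontier_def interior_open)
  moreover have "ennreal (dist x y) \<le> ennreal \<rho>"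
    using ball_subset_imp_le_inradius[OF sub d] assms(3) by (rule order_trans)
  then have "dist x y \<le> \<rho>" using assms(4) by (simp add: ennreal_le_iff)
  ultimately show ?thesis by (rule that)
qed

text \<open>
  Every ball of radius \<open>2 \<rho>\<close> centred in \<open>\<Omega>\<close> contains a ball of radius \<open>r\<close> centred at a frontier
  point, hence a definite part of the complement of \<open>\<Omega>\<close>. Competitors \<open>E\<close> for the Cheeger constant
  lie in \<open>\<Omega>\<close> and therefore miss this part too, so the isoperimetric inequality above applies.
\<close>

lemma cheeger_constant_ge:
  fixes \<Omega> :: "'a::euclidean_space set"
  assumes "open \<Omega>" "inradius \<Omega> \<le> ennreal \<rho>" "0 < r" "r \<le> \<rho>" "0 \<le> q"
    and dens: "\<And>y. y \<in> frontier \<Omega> \<Longrightarrow>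
      ennreal q * emeasure lborel (ball y r) \<le> emeasure lborel (ball y r - \<Omega>)"
  shows "ennreal (q * (r / (2 * \<rho>)) ^ DIM('a) / (displacement_const DIM('a) * (4 * \<rho>)))
    \<le> cheeger_constant \<Omega>"
  unfolding cheeger_constant_def
proof (rule INF_greatest)
  let ?n = "DIM('a)"
  let ?H = "hausdorff_measure (?n - 1) :: 'a set \<Rightarrow> ennreal"
  define K where "K = displacement_const ?n * (4 * \<rho>)"
  define B where "B = unit_ball_vol ?n * (2 * \<rho>) ^ ?n"
  define m where "m = q * (unit_ball_vol ?n * r ^ ?n)"
  have pos: "0 < K" "0 < B" "0 < \<rho>" "0 \<le> m"
    using assms displacement_const_pos[of ?n] by (auto simp: K_def B_def m_def)
  fix E assume "E \<in> {E. E \<noteq> {} \<and> open E \<and> smooth_boundary E \<and> compactly_inside E \<Omega>}"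
  then have E: "E \<noteq> {}" "open E" "compact (closure E)" "closure E \<subseteq> \<Omega>"
    by (auto simp: compactly_inside_def)
  have "ennreal m * emeasure lborel E \<le> ennreal B * (ennreal K * ?H (frontier E))"
  proof -
    have "ennreal m \<le> emeasure lborel (ball x (2 * \<rho>) - E)" if "x \<in> E" for x
    proof -
      have "x \<in> \<Omega>" using that E closure_subset by blast
      then obtain y where y: "y \<in> frontier \<Omega>" "dist x y \<le> \<rho>"
        using exists_frontier_point_within_inradius assms(1,2) pos by metis
      have "ennreal m = ennreal q * emeasure lborel (ball y r)"
        using assms by (simp add: m_def emeasure_ball ennreal_mult')
      also have "\<dots> \<le> emeasure lborel (ball y r - \<Omega>)" using y by (intro dens)
      also have "\<dots> \<le> emeasure lborel (ball x (2 * \<rho>) - E)"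
      proof (rule emeasure_mono)
        show "ball y r - \<Omega> \<subseteq> ball x (2 * \<rho>) - E"
        proof
          fix z assume "z \<in> ball y r - \<Omega>"
          then show "z \<in> ball x (2 * \<rho>) - E"
            using E closure_subset[of E] y assms(4) dist_triangle[of x z y] by auto
        qed
      qed (use E in auto)
      finally show ?thesis .
    qed
    then show ?thesis
      using measure_mult_le_hausdorff_measure[of E "2 * \<rho>" m] E pos by (simp add: K_def B_def)
  qed
  then have "ennreal m * emeasure lborel E \<le> ennreal (B * K) * ?H (frontier E)"
    using pos by (simp add: ennreal_mult' mult.assoc)
  then have "ennreal m * emeasure lborel E / ennreal (B * K) \<le> ennreal (B * K) * ?H (frontier E) / ennreal (B * K)"
    by (rule divide_right_mono_ennreal)
  moreover have "ennreal (B * K) * ?H (frontier E) / ennreal (B * K) = ?H (frontier E)"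
    using pos by (intro ennreal_mult_divide_cancel_left) auto
  moreover have "ennreal m * emeasure lborel E / ennreal (B * K) = ennreal (m / (B * K)) * emeasure lborel E"
    using pos by (simp add: ennreal_times_divide mult.commute flip: divide_ennreal)
  ultimately have "ennreal (m / (B * K)) * emeasure lborel E \<le> ?H (frontier E)" by simp
  then have "ennreal (m / (B * K)) * emeasure lborel E / emeasure lborel E \<le> ?H (frontier E) / emeasure lborel E"
    by (rule divide_right_mono_ennreal)
  moreover have "emeasure lborel E \<noteq> 0"
  proof -
    obtain x e where "0 < e" "ball x e \<subseteq> E" using E(1,2) open_contains_ball by blast
    then have "0 < emeasure lborel (ball x e)" by (simp add: emeasure_ball)
    also have "\<dots> \<le> emeasure lborel E"
      using \<open>ball x e \<subseteq> E\<close> E(2) by (intro emeasure_mono) auto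
    finally show ?thesis by simp
  qed
  moreover have "emeasure lborel E \<noteq> \<infinity>"
    using emeasure_bounded_finite[of E] E by (metis bounded_subset closure_subset compact_imp_bounded infinity_ennreal_def less_irrefl)
  moreover have "m / (B * K) = q * (r / (2 * \<rho>)) ^ ?n / K"
    using pos unit_ball_vol_pos[of "real ?n", THEN less_imp_neq] by (simp add: m_def B_def power_divide field_simps)
  ultimately show "ennreal (q * (r / (2 * \<rho>)) ^ ?n / (displacement_const ?n * (4 * \<rho>)))
      \<le> ?H (frontier E) / emeasure lborel E"
    by (simp add: ennreal_mult_divide_eq K_def)
qed

lemma density_index_imp_measure_ge:
  fixes \<Omega> :: "'a::euclidean_space set"
  assumes "ennreal \<theta> \<le> density_index \<Omega> r\<^sub>0 t" "0 \<le> \<theta>" "0 < r" "r \<le> r\<^sub>0" "y \<in> frontier \<Omega>"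
    and S: "(r\<^sub>0 / r) powr t \<le> S"
  shows "ennreal (\<theta> / S) * emeasure lborel (ball y r) \<le> emeasure lborel (ball y r - \<Omega>)"
proof -
  let ?v = "unit_ball_vol DIM('a) * r ^ DIM('a)"
  have v: "emeasure lborel (ball y r) = ennreal ?v" "0 < ?v"
    using assms by (auto simp: emeasure_ball)
  have "emeasure lborel (ball y r - \<Omega>) \<le> emeasure lborel (ball y r)"
    by (intro emeasure_mono) auto
  then obtain w where w: "emeasure lborel (ball y r - \<Omega>) = ennreal w" "0 \<le> w"
    using v(1) by (cases "emeasure lborel (ball y r - \<Omega>)") (auto simp: top_unique)
  have "0 < (r\<^sub>0 / r) powr t" using assms by simp
  with S have "0 < S" by linarith
  have "density_index \<Omega> r\<^sub>0 t
      \<le> ennreal ((r\<^sub>0 / r) powr t) * (emeasure lborel (ball y r - \<Omega>) / emeasure lborel (ball y r))"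
    unfolding density_index_def using assms by (intro INF_lower2[of "(y, r)"]) auto
  with assms(1) have "ennreal \<theta> \<le> ennreal ((r\<^sub>0 / r) powr t) * (ennreal w / ennreal ?v)"
    unfolding v w by (rule order_trans)
  also have "\<dots> = ennreal ((r\<^sub>0 / r) powr t * (w / ?v))"
    using w v(2) by (simp only: divide_ennreal) (intro ennreal_mult'[symmetric] powr_ge_zero)
  finally have "\<theta> \<le> (r\<^sub>0 / r) powr t * (w / ?v)"
    using v w by (subst (asm) ennreal_le_iff) (auto intro!: mult_nonneg_nonneg divide_nonneg_pos)
  also have "\<dots> \<le> S * (w / ?v)"
    using v w S by (intro mult_right_mono divide_nonneg_pos) auto
  finally have "\<theta> / S * ?v \<le> w"
    using \<open>0 < S\<close> v(2) by (simp add: pos_le_divide_eq pos_divide_le_eq mult.commute)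
  then show ?thesis
    unfolding v w using assms(2) \<open>0 < S\<close> v(2) by (simp flip: ennreal_mult'' add: ennreal_leI)
qed

section \<open>Comparison of the two quantities\<close>

theorem corollary5p9:
  assumes "CARD('n::finite) \<ge> 2"
  shows "\<exists>C :: real \<Rightarrow> real \<Rightarrow> real \<Rightarrow> real \<Rightarrow> real.
    (\<forall>t\<^sub>0 \<theta> \<kappa>\<^sub>1 \<kappa>\<^sub>2. C t\<^sub>0 \<theta> \<kappa>\<^sub>1 \<kappa>\<^sub>2 > 0) \<and>
    (\<forall>t\<^sub>0 \<theta> \<kappa>\<^sub>1 \<kappa>\<^sub>2 r\<^sub>0 t. \<forall>\<Omega> :: (real ^ 'n) set.
       open \<Omega> \<longrightarrow> inradius \<Omega> < \<infinity> \<longrightarrow> 0 < r\<^sub>0 \<longrightarrow> 0 \<le> t \<longrightarrow> t \<le> t\<^sub>0 \<longrightarrow>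
       ennreal \<theta> \<le> density_index \<Omega> r\<^sub>0 t \<longrightarrow> 0 < \<theta> \<longrightarrow>
       0 < \<kappa>\<^sub>1 \<longrightarrow> ennreal \<kappa>\<^sub>1 \<le> ennreal r\<^sub>0 / inradius \<Omega> \<longrightarrow>
       ennreal r\<^sub>0 / inradius \<Omega> \<le> ennreal \<kappa>\<^sub>2 \<longrightarrow>
       bottom_spectrum \<Omega> \<le> ennreal (C t\<^sub>0 \<theta> \<kappa>\<^sub>1 \<kappa>\<^sub>2) * (cheeger_constant \<Omega>)\<^sup>2) \<and>
    (\<forall>\<theta> \<kappa>\<^sub>1 \<kappa>\<^sub>2 \<kappa>\<^sub>2'. C 0 \<theta> \<kappa>\<^sub>1 \<kappa>\<^sub>2 = C 0 \<theta> \<kappa>\<^sub>1 \<kappa>\<^sub>2')"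
proof -
  let ?n = "CARD('n)"
  (* S bounds the weight (r0 / r) powr t at the chosen scale r. The base is at least 1, which
     makes the weight monotone in the exponent and equal to 1, whatever kappa2 is, for t0 = 0. *)
  define S :: "real \<Rightarrow> real \<Rightarrow> real \<Rightarrow> real" where
    "S t\<^sub>0 \<kappa>\<^sub>1 \<kappa>\<^sub>2 = max 1 (\<kappa>\<^sub>2 / min \<kappa>\<^sub>1 1) powr t\<^sub>0" for t\<^sub>0 \<kappa>\<^sub>1 \<kappa>\<^sub>2
  define c where
    "c t\<^sub>0 \<theta> \<kappa>\<^sub>1 \<kappa>\<^sub>2 = \<theta> / S t\<^sub>0 \<kappa>\<^sub>1 \<kappa>\<^sub>2 * (min \<kappa>\<^sub>1 1 / 2) ^ ?n / (displacement_const ?n * 4)"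
    for t\<^sub>0 \<theta> \<kappa>\<^sub>1 \<kappa>\<^sub>2
  define A :: real where "A = 64 * 2 ^ ?n * exp (8/3)"
  (* The summand 1 makes C positive for all arguments, including those for which c vanishes. *)
  define C where "C t\<^sub>0 \<theta> \<kappa>\<^sub>1 \<kappa>\<^sub>2 = 1 + A / (c t\<^sub>0 \<theta> \<kappa>\<^sub>1 \<kappa>\<^sub>2)\<^sup>2" for t\<^sub>0 \<theta> \<kappa>\<^sub>1 \<kappa>\<^sub>2
  have A: "0 < A" by (simp add: A_def)
  have "C t\<^sub>0 \<theta> \<kappa>\<^sub>1 \<kappa>\<^sub>2 > 0" for t\<^sub>0 \<theta> \<kappa>\<^sub>1 \<kappa>\<^sub>2
    using A by (auto simp: C_def intro!: add_pos_nonneg)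
  moreover have "C 0 \<theta> \<kappa>\<^sub>1 \<kappa>\<^sub>2 = C 0 \<theta> \<kappa>\<^sub>1 \<kappa>\<^sub>2'" for \<theta> \<kappa>\<^sub>1 \<kappa>\<^sub>2 \<kappa>\<^sub>2'
  proof -
    have "S 0 \<kappa>\<^sub>1 k = 1" for k by (simp add: S_def)
    then show ?thesis by (simp only: C_def c_def)
  qed
  moreover have "bottom_spectrum \<Omega> \<le> ennreal (C t\<^sub>0 \<theta> \<kappa>\<^sub>1 \<kappa>\<^sub>2) * (cheeger_constant \<Omega>)\<^sup>2"
    if "open \<Omega>" and fin: "inradius \<Omega> < \<infinity>" and "0 < r\<^sub>0" "0 \<le> t" "t \<le> t\<^sub>0"
      and dens: "ennreal \<theta> \<le> density_index \<Omega> r\<^sub>0 t" and "0 < \<theta>" "0 < \<kappa>\<^sub>1"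
      and \<kappa>1: "ennreal \<kappa>\<^sub>1 \<le> ennreal r\<^sub>0 / inradius \<Omega>"
      and \<kappa>2: "ennreal r\<^sub>0 / inradius \<Omega> \<le> ennreal \<kappa>\<^sub>2"
    for t\<^sub>0 \<theta> \<kappa>\<^sub>1 \<kappa>\<^sub>2 r\<^sub>0 t and \<Omega> :: "(real ^ 'n) set"
  proof -
    have "inradius \<Omega> \<noteq> 0"
      using \<kappa>2 \<open>0 < r\<^sub>0\<close> by (auto simp: ennreal_divide_zero top_unique)
    with fin obtain \<rho> where \<rho>: "inradius \<Omega> = ennreal \<rho>" "0 < \<rho>"
      by (cases "inradius \<Omega>") (auto simp: less_le)
    (* The density is used at the scale k * rho, the multiple of the inradius not exceeding
       min r0 rho that is available for every admissible r0. *)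
    define k where "k = min \<kappa>\<^sub>1 1"
    have k: "0 < k" "k \<le> 1" "k \<le> \<kappa>\<^sub>1" using \<open>0 < \<kappa>\<^sub>1\<close> by (auto simp: k_def)
    have ratio: "ennreal r\<^sub>0 / inradius \<Omega> = ennreal (r\<^sub>0 / \<rho>)"
      using \<rho> \<open>0 < r\<^sub>0\<close> by (simp add: divide_ennreal)
    have "\<kappa>\<^sub>1 \<le> r\<^sub>0 / \<rho>"
      using \<kappa>1 \<rho> \<open>0 < r\<^sub>0\<close> unfolding ratio by (subst (asm) ennreal_le_iff) auto
    then have "k * \<rho> \<le> r\<^sub>0" using k(3) \<rho>(2) by (simp add: pos_le_divide_eq) (meson mult_right_mono order_trans less_imp_le)
    have "r\<^sub>0 / \<rho> \<le> \<kappa>\<^sub>2"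
    proof (rule ccontr)
      assume "\<not> r\<^sub>0 / \<rho> \<le> \<kappa>\<^sub>2"
      then have "ennreal \<kappa>\<^sub>2 < ennreal (r\<^sub>0 / \<rho>)"
        using \<rho> \<open>0 < r\<^sub>0\<close> by (intro ennreal_lessI) auto
      with \<kappa>2 show False unfolding ratio by simp
    qed
    then have "r\<^sub>0 / (k * \<rho>) \<le> max 1 (\<kappa>\<^sub>2 / k)"
      using k \<rho> by (simp add: le_max_iff_disj field_simps)
    then have "(r\<^sub>0 / (k * \<rho>)) powr t \<le> max 1 (\<kappa>\<^sub>2 / k) powr t"
      using k \<rho> \<open>0 < r\<^sub>0\<close> \<open>0 \<le> t\<close> by (intro powr_mono2) auto
    also have "\<dots> \<le> S t\<^sub>0 \<kappa>\<^sub>1 \<kappa>\<^sub>2"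
      unfolding S_def k_def[symmetric] using \<open>t \<le> t\<^sub>0\<close> by (intro powr_mono) auto
    finally have S: "(r\<^sub>0 / (k * \<rho>)) powr t \<le> S t\<^sub>0 \<kappa>\<^sub>1 \<kappa>\<^sub>2" .
    have S_pos: "0 < S t\<^sub>0 \<kappa>\<^sub>1 \<kappa>\<^sub>2" by (simp add: S_def)
    let ?c = "c t\<^sub>0 \<theta> \<kappa>\<^sub>1 \<kappa>\<^sub>2"
    have c: "0 < ?c"
      using S_pos k \<open>0 < \<theta>\<close> displacement_const_pos[of ?n]
      unfolding c_def k_def[symmetric] by (intro divide_pos_pos mult_pos_pos) auto
    have "ennreal (\<theta> / S t\<^sub>0 \<kappa>\<^sub>1 \<kappa>\<^sub>2 * (k * \<rho> / (2 * \<rho>)) ^ ?n / (displacement_const ?n * (4 * \<rho>)))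
        \<le> cheeger_constant \<Omega>"
      using cheeger_constant_ge[of \<Omega> \<rho> "k * \<rho>" "\<theta> / S t\<^sub>0 \<kappa>\<^sub>1 \<kappa>\<^sub>2"]
        density_index_imp_measure_ge[OF dens _ _ _ _ S] that k \<rho> \<open>k * \<rho> \<le> r\<^sub>0\<close> S_pos
      by (simp add: mult_left_le_one_le)
    also have "\<theta> / S t\<^sub>0 \<kappa>\<^sub>1 \<kappa>\<^sub>2 * (k * \<rho> / (2 * \<rho>)) ^ ?n / (displacement_const ?n * (4 * \<rho>)) = ?c / \<rho>"
      using \<rho> by (simp add: c_def k_def)
    finally have h: "ennreal (?c / \<rho>) \<le> cheeger_constant \<Omega>" .
    have "bottom_spectrum \<Omega> \<le> ennreal (A / \<rho>\<^sup>2)"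
      using bottom_spectrum_le_inradius[OF \<rho>] by (simp add: A_def)
    also have "A / \<rho>\<^sup>2 = A / ?c\<^sup>2 * (?c / \<rho>)\<^sup>2"
      using c by (simp add: power_divide)
    also have "ennreal \<dots> = ennreal (A / ?c\<^sup>2) * (ennreal (?c / \<rho>))\<^sup>2"
      unfolding ennreal_power[OF divide_nonneg_nonneg[OF less_imp_le[OF c] less_imp_le[OF \<rho>(2)]]]
      using A by (intro ennreal_mult') auto
    also have "\<dots> \<le> ennreal (C t\<^sub>0 \<theta> \<kappa>\<^sub>1 \<kappa>\<^sub>2) * (cheeger_constant \<Omega>)\<^sup>2"
      using h by (intro mult_mono power_mono ennreal_leI) (auto simp: C_def)
    finally show ?thesis .
  qed
  ultimately show ?thesis by blast
qed

end
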